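(* For every hypergraph $H$, the finite symmetric simplicial set $\mathcal{K}(H)$ induced by $H$ is closed and Čech.
   Context: Symmetric simplicial sets. Let $[n]=\{0,\dots,n\}$. The category $!\Delta$ has objects $[n]$, $n\ge 0$, and all functions as morphisms. A symmetric simplicial set is a functor $X:{!\Delta}^{\mathrm{op}}\to\mathbf{Set}$ (finite if it takes values in finite sets). Write $X_n=X([n])$, $\widehat{X}=\coprod_{n\ge0}X_n$, preordered by: for $x\in X_m$, $y\in X_n$, $x\lesssim y$ iff $X(\mu)(y)=x$ for some function $\mu:[m]\to[n]$. For $y\in\widehat{X}$ put $U_y=\{z\in\widehat{X}\mid z\gtrsim y\}$. Closed, Čech. $\check{C}(X)$ is the symmetric simplicial set with $\check{C}(X)_n=\{(y_0,\dots,y_n)\in (X_0)^{n+1}\mid U_{y_0}\cap\cdots\cap U_{y_n}\neq\emptyset\}$ and $\check{C}(X)(\mu)(y_0,\dots,y_n)=(y_{\mu(0)},\dots,y_{\mu(m)})$ for $\mu:[m]\to[n]$. With $(k)_{[n]}:[0]\to[n]$ the map with value $k$, let $\psi_n:X_n\to\check{C}(X)_n$, $\psi_n(y)=(X((0)_{[n]})(y),\dots,X((n)_{[n]})(y))$. $X$ is closed if $\{\emptyset\}\cup\{U_y\}_{y\in\widehat{X}}$ is closed under finite intersections (of nonempty finite families); $X$ is Čech if $\psi=\{\psi_n\}:X\to\check{C}(X)$ is an isomorphism of symmetric simplicial sets. Hypergraphs. A hypergraph is a triple $H=(E(H),V(H),f_H)$ with $E(H),V(H)$ finite sets and $f_H$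 a map from $E(H)$ to the nonempty subsets of $V(H)$ such that no $f_H(e)$ is a singleton. Put $\tilde f_H(e)=f_H(e)$ for $e\in E(H)$ and $\tilde f_H(v)=\{v\}$ for $v\in V(H)$. $\mathcal{K}(H)_n$ is the quotient of the disjoint union over $x\in E(H)\coprod V(H)$ of the sets of $(n+1)$-tuples in $\tilde f_H(x)$ by the equivalence relation generated by identifying a tuple in $\tilde f_H(x)$ with the same tuple in $\tilde f_H(x')$ whenever all its entries lie in $\tilde f_H(x)\cap\tilde f_H(x')$. The class of $(v_0,\dots,v_n)$ in $\tilde f_H(x)$ is $[v_0,\dots,v_n]_x$, and $\mathcal{K}(H)(\mu)([v_0,\dots,v_n]_x)=[v_{\mu(0)},\dots,v_{\mu(m)}]_x$ for $\mu:[m]\to[n]$. *)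

theory Defs
  imports "HOL-Library.FuncSet"
begin

section \<open>Symmetric simplicial sets\<close>

text \<open>
  The object \<open>[n]\<close> of the category \<open>!\<Delta>\<close> is the set \<open>{..n}\<close>. Morphisms are represented by
  extensional functions, so that equality of morphisms \<open>[m] \<rightarrow> [n]\<close> is equality in HOL; identities
  and composition are \<open>restrict id\<close> and \<open>compose\<close>. Tuples \<open>(v\<^sub>0, \<dots>, v\<^sub>n)\<close> are likewise extensional
  functions on \<open>{..n}\<close>.
\<close>

abbreviation (input) sDelta_hom :: "nat \<Rightarrow> nat \<Rightarrow> (nat \<Rightarrow> nat) set" where
  "sDelta_hom m n \<equiv> {..m} \<rightarrow>\<^sub>E {..n}"

text \<open>
  For \<open>\<mu> : [m] \<rightarrow> [n]\<close>, the term \<open>act X m n \<mu>\<close> is the map \<open>X(\<mu>)\<close> from \<open>cells X n\<close> to \<open>cells X m\<close>;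
  only its values on \<open>cells X n\<close> are relevant. The source and target of \<open>\<mu>\<close> are passed explicitly because
  an extensional function does not determine its codomain.
\<close>

record 'a sym_sset =
  cells :: "nat \<Rightarrow> 'a set"
  act :: "nat \<Rightarrow> nat \<Rightarrow> (nat \<Rightarrow> nat) \<Rightarrow> 'a \<Rightarrow> 'a"

locale sym_sset =
  fixes X :: "'a sym_sset"
  assumes act_closed:
      "\<lbrakk>\<mu> \<in> sDelta_hom m n; x \<in> cells X n\<rbrakk> \<Longrightarrow> act X m n \<mu> x \<in> cells X m"
    and act_id:
      "x \<in> cells X n \<Longrightarrow> act X n n (restrict id {..n}) x = x"
    and act_comp:
      "\<lbrakk>\<mu> \<in> sDelta_hom l m; \<nu> \<in> sDelta_hom m n; x \<in> cells X n\<rbrakk>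
        \<Longrightarrow> act X l n (compose {..l} \<nu> \<mu>) x = act X l m \<mu> (act X m n \<nu> x)"

locale finite_sym_sset = sym_sset X for X :: "'a sym_sset" +
  assumes finite_cells: "finite (cells X n)"

definition sset_morphism ::
  "'a sym_sset \<Rightarrow> 'b sym_sset \<Rightarrow> (nat \<Rightarrow> 'a \<Rightarrow> 'b) \<Rightarrow> bool" where
  "sset_morphism X Y \<phi> \<longleftrightarrow> sym_sset X \<and> sym_sset Y
    \<and> (\<forall>n. \<forall>x \<in> cells X n. \<phi> n x \<in> cells Y n)
    \<and> (\<forall>m n. \<forall>\<mu> \<in> sDelta_hom m n. \<forall>x \<in> cells X n.
          \<phi> m (act X m n \<mu> x) = act Y m n \<mu> (\<phi> n x))"

definition sset_isomorphism ::
  "'a sym_sset \<Rightarrow> 'b sym_sset \<Rightarrow> (nat \<Rightarrow> 'a \<Rightarrow> 'b) \<Rightarrow> bool" where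
  "sset_isomorphism X Y \<phi> \<longleftrightarrow> sset_morphism X Y \<phi>
    \<and> (\<exists>\<chi>. sset_morphism Y X \<chi>
          \<and> (\<forall>n. \<forall>x \<in> cells X n. \<chi> n (\<phi> n x) = x)
          \<and> (\<forall>n. \<forall>y \<in> cells Y n. \<phi> n (\<chi> n y) = y))"


section \<open>Closed and \v{C}ech\<close>

definition total_cells :: "'a sym_sset \<Rightarrow> (nat \<times> 'a) set" where
  "total_cells X = (SIGMA n:UNIV. cells X n)"

definition cell_le :: "'a sym_sset \<Rightarrow> nat \<times> 'a \<Rightarrow> nat \<times> 'a \<Rightarrow> bool" where
  "cell_le X = (\<lambda>(m, x) (n, y). \<exists>\<mu> \<in> sDelta_hom m n. act X m n \<mu> y = x)"

definition up_set :: "'a sym_sset \<Rightarrow> nat \<times> 'a \<Rightarrow> (nat \<times> 'a) set" where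
  "up_set X y = {z \<in> total_cells X. cell_le X y z}"

definition closed_sset :: "'a sym_sset \<Rightarrow> bool" where
  "closed_sset X \<longleftrightarrow>
    (\<forall>\<F>. finite \<F> \<and> \<F> \<noteq> {} \<and> \<F> \<subseteq> {{}} \<union> up_set X ` total_cells X
        \<longrightarrow> \<Inter>\<F> \<in> {{}} \<union> up_set X ` total_cells X)"

definition cech :: "'a sym_sset \<Rightarrow> (nat \<Rightarrow> 'a) sym_sset" where
  "cech X = \<lparr>cells = (\<lambda>n. {y \<in> {..n} \<rightarrow>\<^sub>E cells X 0. (\<Inter>i\<in>{..n}. up_set X (0, y i)) \<noteq> {}}),
             act = (\<lambda>m n \<mu> y. compose {..m} y \<mu>)\<rparr>"

definition vertex_map :: "'a sym_sset \<Rightarrow> nat \<Rightarrow> 'a \<Rightarrow> nat \<Rightarrow> 'a" where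
  "vertex_map X n y = (\<lambda>k\<in>{..n}. act X 0 n (\<lambda>i\<in>{..0}. k) y)"

definition cech_sset :: "'a sym_sset \<Rightarrow> bool" where
  "cech_sset X \<longleftrightarrow> sset_isomorphism X (cech X) (vertex_map X)"


section \<open>Hypergraphs\<close>

record ('e, 'v) hypergraph =
  edges :: "'e set"
  verts :: "'v set"
  ends :: "'e \<Rightarrow> 'v set"

locale hypergraph =
  fixes H :: "('e, 'v) hypergraph"
  assumes finite_edges: "finite (edges H)"
    and finite_verts: "finite (verts H)"
    and ends_subset: "e \<in> edges H \<Longrightarrow> ends H e \<subseteq> verts H"
    and ends_nonempty: "e \<in> edges H \<Longrightarrow> ends H e \<noteq> {}"
    and ends_not_singleton: "e \<in> edges H \<Longrightarrow> \<not> is_singleton (ends H e)"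

definition ext_ends :: "('e, 'v) hypergraph \<Rightarrow> 'e + 'v \<Rightarrow> 'v set" where
  "ext_ends H = case_sum (ends H) (\<lambda>v. {v})"

definition K_pre :: "('e, 'v) hypergraph \<Rightarrow> nat \<Rightarrow> (('e + 'v) \<times> (nat \<Rightarrow> 'v)) set" where
  "K_pre H n = (SIGMA x:edges H <+> verts H. {..n} \<rightarrow>\<^sub>E ext_ends H x)"

definition K_ident :: "('e, 'v) hypergraph \<Rightarrow> nat
    \<Rightarrow> ('e + 'v) \<times> (nat \<Rightarrow> 'v) \<Rightarrow> ('e + 'v) \<times> (nat \<Rightarrow> 'v) \<Rightarrow> bool" where
  "K_ident H n = (\<lambda>(x, t) (x', t'). x \<in> edges H <+> verts H \<and> x' \<in> edges H <+> verts H
      \<and> t' = t \<and> t \<in> {..n} \<rightarrow>\<^sub>E ext_ends H x \<inter> ext_ends H x')"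

definition K_rel :: "('e, 'v) hypergraph \<Rightarrow> nat
    \<Rightarrow> ((('e + 'v) \<times> (nat \<Rightarrow> 'v)) \<times> (('e + 'v) \<times> (nat \<Rightarrow> 'v))) set" where
  "K_rel H n = {(p, q) \<in> K_pre H n \<times> K_pre H n. equivclp (K_ident H n) p q}"

definition K_class :: "('e, 'v) hypergraph \<Rightarrow> nat \<Rightarrow> 'e + 'v \<Rightarrow> (nat \<Rightarrow> 'v)
    \<Rightarrow> (('e + 'v) \<times> (nat \<Rightarrow> 'v)) set" where
  "K_class H n x t = K_rel H n `` {(x, t)}"

text \<open>
  The action on a class is the union of the classes of the images of all its representatives; these
  images are all equivalent, so the union is a single class (see \<open>act_K_class\<close> below).
\<close>

definition K :: "('e, 'v) hypergraph \<Rightarrow> (('e + 'v) \<times> (nat \<Rightarrow> 'v)) set sym_sset" where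
  "K H = \<lparr>cells = (\<lambda>n. K_pre H n // K_rel H n),
          act = (\<lambda>m n \<mu> c. \<Union>(x, t)\<in>c. K_class H m x (compose {..m} t \<mu>))\<rparr>"

lemma K_rel_snd_eq:
  assumes "((x, t), (x', t')) \<in> K_rel H n"
  shows "t' = t"
proof -
  have *: "snd q = snd p" if "equivclp (K_ident H n) p q" for p q
    using that by (induction rule: equivclp_induct) (auto simp: K_ident_def)
  show ?thesis
    using assms *[of "(x, t)" "(x', t')"] by (simp add: K_rel_def)
qed

lemma equiv_K_rel: "equiv (K_pre H n) (K_rel H n)"
proof (rule equivI)
  show "K_rel H n \<subseteq> K_pre H n \<times> K_pre H n"
    unfolding K_rel_def by blast
  show "refl_on (K_pre H n) (K_rel H n)"
    unfolding K_rel_def refl_on_def by (simp add: equivclp_def)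
  show "sym (K_rel H n)"
    unfolding K_rel_def sym_def using equivclp_sym by fast
  show "trans (K_rel H n)"
    unfolding K_rel_def trans_def using equivclp_trans by fast
qed

lemma K_rel_iff:
  "((x, t), (x', t')) \<in> K_rel H n \<longleftrightarrow> (x, t) \<in> K_pre H n \<and> (x', t') \<in> K_pre H n \<and> t' = t"
proof
  assume "((x, t), (x', t')) \<in> K_rel H n"
  then show "(x, t) \<in> K_pre H n \<and> (x', t') \<in> K_pre H n \<and> t' = t"
    using K_rel_snd_eq[of x t x' t' H n] by (simp add: K_rel_def)
next
  assume "(x, t) \<in> K_pre H n \<and> (x', t') \<in> K_pre H n \<and> t' = t"
  moreover from this have "K_ident H n (x, t) (x', t')"
    by (auto simp: K_ident_def K_pre_def PiE_iff)
  ultimately show "((x, t), (x', t')) \<in> K_rel H n"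
    by (auto simp: K_rel_def)
qed

lemma act_K_class:
  assumes "\<mu> \<in> sDelta_hom m n" and "(x, t) \<in> K_pre H n"
  shows "act (K H) m n \<mu> (K_class H n x t) = K_class H m x (compose {..m} t \<mu>)"
proof -
  have pre: "(x', compose {..m} t \<mu>) \<in> K_pre H m" if "(x', t) \<in> K_pre H n" for x'
    using that assms(1) by (auto simp: K_pre_def compose_def PiE_iff)
  have "K_class H m x' (compose {..m} t' \<mu>) = K_class H m x (compose {..m} t \<mu>)"
    if "(x', t') \<in> K_class H n x t" for x' t'
  proof -
    have "t' = t" "(x', t) \<in> K_pre H n"
      using that by (auto simp: K_class_def K_rel_iff)
    then show ?thesis
      using pre assms(2) unfolding K_class_def
      by (intro equiv_class_eq[OF equiv_K_rel]) (auto simp: K_rel_iff)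
  qed
  moreover have "(x, t) \<in> K_class H n x t"
    using assms(2) by (auto simp: K_class_def K_rel_iff)
  ultimately have "(\<Union>(x', t')\<in>K_class H n x t. K_class H m x' (compose {..m} t' \<mu>))
      = K_class H m x (compose {..m} t \<mu>)"
    by blast
  then show ?thesis
    by (simp add: K_def)
qed

end

theory Submission
  imports Defs
begin

text \<open>
  Since the equivalence relation on \<open>K_pre H n\<close> identifies pairs exactly when their tuples agree, an
  \<open>n\<close>-cell of \<open>K H\<close> is nothing but a tuple whose set of entries is a \<^emph>\<open>face\<close> of \<open>H\<close>, that is, lies in a
  hyperedge or in a single vertex. There are finitely many such tuples, and the other two properties
  follow from this description as well.

  A tuple \<open>t\<close> is obtained from a tuple \<open>s\<close> by reindexing iff the entries of \<open>t\<close> are among those of \<open>s\<close>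
  (\<open>reindexing_exists_iff\<close>). Hence \<open>U\<^sub>t\<close> depends only on the set \<open>A\<close> of entries of \<open>t\<close>: it consists of the
  cells whose entries include \<open>A\<close>, a set written \<open>cells_over H A\<close> below. Visibly
  \<open>cells_over H A \<inter> cells_over H B = cells_over H (A \<union> B)\<close>, and this is again some \<open>U\<^sub>z\<close> when \<open>A \<union> B\<close> is
  a face, where \<open>z\<close> is an enumeration of \<open>A \<union> B\<close>, and empty otherwise. So \<open>K H\<close> is closed.

  For the Cech property, the vertex map is a morphism for every symmetric simplicial set, so only
  bijectivity is at stake (\<open>cech_ssetI\<close>). A cell of \<open>K H\<close> is determined by its entries, which gives
  injectivity. Conversely, if \<open>U\<close> of the vertices \<open>v\<^sub>0, \<dots>, v\<^sub>n\<close> have a common element, its entries form a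
  face containing all \<open>v\<^sub>i\<close>, so \<open>(v\<^sub>0, \<dots>, v\<^sub>n)\<close> is itself a cell.
\<close>

section \<open>The vertex map of a symmetric simplicial set\<close>

lemma vertex_map_in_PiE:
  assumes "sym_sset X" and "y \<in> cells X n"
  shows "vertex_map X n y \<in> {..n} \<rightarrow>\<^sub>E cells X 0"
  using assms(2) unfolding vertex_map_def
  by (intro restrict_PiE_iff[THEN iffD2] ballI sym_sset.act_closed[OF assms(1)]) auto

lemma cells_cech_iff:
  "y \<in> cells (cech X) n \<longleftrightarrow>
    y \<in> {..n} \<rightarrow>\<^sub>E cells X 0 \<and> (\<Inter>i\<in>{..n}. up_set X (0, y i)) \<noteq> {}"
  by (simp only: cech_def sym_sset.select_convs mem_Collect_eq)

lemma act_cech: "act (cech X) m n \<mu> y = compose {..m} y \<mu>"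
  by (simp only: cech_def sym_sset.select_convs)

text \<open>The cell \<open>y\<close> itself witnesses that its vertices satisfy the intersection condition.\<close>

lemma vertex_map_in_cech:
  assumes "sym_sset X" and "y \<in> cells X n"
  shows "vertex_map X n y \<in> cells (cech X) n"
proof -
  have "(n, y) \<in> up_set X (0, vertex_map X n y i)" if "i \<in> {..n}" for i
  proof -
    have "(\<lambda>_\<in>{..0}. i) \<in> sDelta_hom 0 n"
      using that by (intro restrict_PiE_iff[THEN iffD2]) simp
    moreover have "act X 0 n (\<lambda>_\<in>{..0}. i) y = vertex_map X n y i"
      using that by (simp add: vertex_map_def)
    ultimately show ?thesis
      using assms(2) unfolding up_set_def total_cells_def cell_le_def by blast
  qed
  then show ?thesis
    using vertex_map_in_PiE[OF assms] unfolding cells_cech_iff by blast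
qed

lemma sym_sset_cech: "sym_sset (cech X)"
proof
  fix \<mu> m n y
  assume \<mu>: "\<mu> \<in> sDelta_hom m n" and y_cech: "y \<in> cells (cech X) n"
  note y = y_cech[unfolded cells_cech_iff, THEN conjunct1]
    and ne = y_cech[unfolded cells_cech_iff, THEN conjunct2]
  \<comment> \<open>Reindexing intersects a subfamily of the same up-sets, which can only get larger.\<close>
  have "(\<Inter>i\<in>{..n}. up_set X (0, y i)) \<subseteq> up_set X (0, compose {..m} y \<mu> j)"
    if j: "j \<in> {..m}" for j
    unfolding compose_eq[OF j] by (rule INF_lower) (rule PiE_mem[OF \<mu> j])
  then have "(\<Inter>i\<in>{..n}. up_set X (0, y i))
      \<subseteq> (\<Inter>i\<in>{..m}. up_set X (0, compose {..m} y \<mu> i))"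
    by (rule INF_greatest)
  then have "(\<Inter>i\<in>{..m}. up_set X (0, compose {..m} y \<mu> i)) \<noteq> {}"
    using ne by (metis subset_empty)
  moreover have "compose {..m} y \<mu> \<in> {..m} \<rightarrow>\<^sub>E cells X 0"
    unfolding compose_def restrict_PiE_iff by (intro ballI PiE_mem[OF y] PiE_mem[OF \<mu>])
  ultimately show "act (cech X) m n \<mu> y \<in> cells (cech X) m"
    unfolding act_cech cells_cech_iff by (rule conjI[rotated])
next
  fix y n
  assume "y \<in> cells (cech X) n"
  then have "y \<in> {..n} \<rightarrow>\<^sub>E cells X 0"
    unfolding cells_cech_iff by (rule conjunct1)
  then show "act (cech X) n n (restrict id {..n}) y = y"
    using compose_Id[of y "{..n}" "cells X 0"] by (simp add: act_cech id_def PiE_def)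
next
  fix \<mu> \<nu> y l m n
  assume "\<mu> \<in> sDelta_hom l m"
  then show "act (cech X) l n (compose {..l} \<nu> \<mu>) y
      = act (cech X) l m \<mu> (act (cech X) m n \<nu> y)"
    using compose_assoc[of \<mu> "{..l}" "{..m}" y \<nu>] by (simp add: act_cech PiE_def)
qed

text \<open>
  Naturality reduces, entry by entry, to the fact that \<open>k : [0] \<rightarrow> [m]\<close> followed by \<open>\<mu> : [m] \<rightarrow> [n]\<close> is
  \<open>\<mu>(k) : [0] \<rightarrow> [n]\<close>.
\<close>

lemma vertex_map_natural:
  assumes "sym_sset X" and \<mu>: "\<mu> \<in> sDelta_hom m n" and "y \<in> cells X n"
  shows "vertex_map X m (act X m n \<mu> y) = act (cech X) m n \<mu> (vertex_map X n y)"
proof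
  fix k
  show "vertex_map X m (act X m n \<mu> y) k = act (cech X) m n \<mu> (vertex_map X n y) k"
  proof (cases "k \<le> m")
    case True
    then have k: "(\<lambda>_\<in>{..0}. k) \<in> sDelta_hom 0 m"
      by (intro restrict_PiE_iff[THEN iffD2]) simp
    have "vertex_map X m (act X m n \<mu> y) k = act X 0 m (\<lambda>_\<in>{..0}. k) (act X m n \<mu> y)"
      using True by (simp add: vertex_map_def)
    also have "\<dots> = act X 0 n (compose {..0} \<mu> (\<lambda>_\<in>{..0}. k)) y"
      by (rule sym_sset.act_comp[OF assms(1) k \<mu> assms(3), symmetric])
    also have "compose {..0::nat} \<mu> (\<lambda>_\<in>{..0}. k) = (\<lambda>_\<in>{..0}. \<mu> k)"
      unfolding compose_def by (rule restrict_ext) simp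
    also have "act X 0 n \<dots> y = act (cech X) m n \<mu> (vertex_map X n y) k"
      using True PiE_mem[OF \<mu>, of k] by (simp add: vertex_map_def act_cech compose_def)
    finally show ?thesis .
  qed (simp add: vertex_map_def act_cech compose_def)
qed

lemma vertex_map_morphism:
  assumes "sym_sset X"
  shows "sset_morphism X (cech X) (vertex_map X)"
  unfolding sset_morphism_def
  by (intro conjI allI ballI assms sym_sset_cech vertex_map_in_cech vertex_map_natural)

text \<open>Levelwise inverses of a morphism are automatically natural.\<close>

lemma sset_isomorphismI:
  assumes \<phi>: "sset_morphism X Y \<phi>" and bij: "\<And>n. bij_betw (\<phi> n) (cells X n) (cells Y n)"
  shows "sset_isomorphism X Y \<phi>"
proof -
  define \<chi> where "\<chi> n = inv_into (cells X n) (\<phi> n)" for n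
  have X: "sym_sset X" and Y: "sym_sset Y"
    and nat: "\<And>m n \<mu> x. \<mu> \<in> sDelta_hom m n \<Longrightarrow> x \<in> cells X n
      \<Longrightarrow> \<phi> m (act X m n \<mu> x) = act Y m n \<mu> (\<phi> n x)"
    using \<phi> by (auto simp: sset_morphism_def)
  have \<chi>\<phi>: "\<chi> n (\<phi> n x) = x" if "x \<in> cells X n" for n x
    unfolding \<chi>_def by (rule bij_betw_inv_into_left[OF bij that])
  have \<phi>\<chi>: "\<phi> n (\<chi> n y) = y" if "y \<in> cells Y n" for n y
    unfolding \<chi>_def by (rule bij_betw_inv_into_right[OF bij that])
  have \<chi>_cells: "\<chi> n y \<in> cells X n" if "y \<in> cells Y n" for n y
    using that bij_betw_apply[OF bij_betw_inv_into[OF bij]] by (simp add: \<chi>_def)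
  have "\<chi> m (act Y m n \<mu> y) = act X m n \<mu> (\<chi> n y)"
    if "\<mu> \<in> sDelta_hom m n" "y \<in> cells Y n" for m n \<mu> y
  proof -
    have "act Y m n \<mu> y = \<phi> m (act X m n \<mu> (\<chi> n y))"
      using that nat \<chi>_cells \<phi>\<chi> by simp
    then show ?thesis
      using that \<chi>_cells \<chi>\<phi> sym_sset.act_closed[OF X] by simp
  qed
  then have "sset_morphism Y X \<chi>"
    using X Y \<chi>_cells by (simp add: sset_morphism_def)
  then show ?thesis
    using \<phi> \<chi>\<phi> \<phi>\<chi> by (auto simp: sset_isomorphism_def)
qed

lemma cech_ssetI:
  assumes "sym_sset X"
    and "\<And>n. inj_on (vertex_map X n) (cells X n)"
    and "\<And>n. cells (cech X) n \<subseteq> vertex_map X n ` cells X n"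
  shows "cech_sset X"
proof -
  have "bij_betw (vertex_map X n) (cells X n) (cells (cech X) n)" for n
    using assms vertex_map_in_cech[OF assms(1)] by (auto simp: bij_betw_def)
  then show ?thesis
    unfolding cech_sset_def
    using sset_isomorphismI vertex_map_morphism[OF assms(1)] by blast
qed


section \<open>Tuples and their sets of entries\<close>

lemma image_compose_subset:
  assumes "\<mu> \<in> {..m} \<rightarrow>\<^sub>E {..n}"
  shows "compose {..m} t \<mu> ` {..m} \<subseteq> t ` {..n}"
  using PiE_mem[OF assms] by (simp add: compose_def image_subset_iff)

text \<open>Only the sets of entries matter: for each index of \<open>t\<close>, choose a position of its entry in \<open>s\<close>.\<close>

lemma reindexing_exists_iff:
  fixes t s :: "nat \<Rightarrow> 'v"
  assumes "t \<in> extensional {..m}"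
  shows "(\<exists>\<mu> \<in> sDelta_hom m n. compose {..m} s \<mu> = t) \<longleftrightarrow> t ` {..m} \<subseteq> s ` {..n}"
proof
  assume "t ` {..m} \<subseteq> s ` {..n}"
  then have "\<forall>i\<in>{..m}. \<exists>j\<in>{..n}. s j = t i"
    by (fastforce simp: image_subset_iff)
  then obtain f where f: "\<And>i. i \<in> {..m} \<Longrightarrow> f i \<in> {..n} \<and> s (f i) = t i"
    using bchoice[of "{..m}" "\<lambda>i j. j \<in> {..n} \<and> s j = t i"] by blast
  then have "compose {..m} s (restrict f {..m}) = t"
    using assms by (auto simp: compose_def fun_eq_iff extensional_def)
  moreover have "restrict f {..m} \<in> sDelta_hom m n"
    using f by auto
  ultimately show "\<exists>\<mu> \<in> sDelta_hom m n. compose {..m} s \<mu> = t"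
    by blast
next
  assume "\<exists>\<mu> \<in> sDelta_hom m n. compose {..m} s \<mu> = t"
  then show "t ` {..m} \<subseteq> s ` {..n}"
    using image_compose_subset by metis
qed

lemma exists_tuple_with_entries:
  assumes "finite A" and "A \<noteq> {}"
  obtains n and t :: "nat \<Rightarrow> 'v" where "t \<in> extensional {..n}" and "t ` {..n} = A"
proof -
  obtain n where n: "card A = Suc n"
    using assms by (metis card_0_eq not0_implies_Suc)
  obtain f where "bij_betw f {0..<card A} A"
    using ex_bij_betw_nat_finite[OF assms(1)] by blast
  then have "f ` {..n} = A"
    by (simp add: n bij_betw_def atLeast0LessThan lessThan_Suc_atMost)
  then have "restrict f {..n} ` {..n} = A"
    by simp
  then show thesis
    using that restrict_extensional by blast
qed


section \<open>Cells of \<open>K H\<close> as tuples spanning a face\<close>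

definition face :: "('e, 'v) hypergraph \<Rightarrow> 'v set \<Rightarrow> bool" where
  "face H A \<longleftrightarrow> (\<exists>x \<in> edges H <+> verts H. A \<subseteq> ext_ends H x)"

definition face_tuples :: "('e, 'v) hypergraph \<Rightarrow> nat \<Rightarrow> (nat \<Rightarrow> 'v) set" where
  "face_tuples H n = {t \<in> extensional {..n}. face H (t ` {..n})}"

text \<open>
  This is \<open>[t]\<^sub>x\<close>, which is the same class for every \<open>x\<close> whose vertices include the entries of \<open>t\<close>.
\<close>

definition tuple_cell ::
  "('e, 'v) hypergraph \<Rightarrow> nat \<Rightarrow> (nat \<Rightarrow> 'v) \<Rightarrow> (('e + 'v) \<times> (nat \<Rightarrow> 'v)) set" where
  "tuple_cell H n t = {(x, t) | x. (x, t) \<in> K_pre H n}"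

lemma face_subset: "face H B \<Longrightarrow> A \<subseteq> B \<Longrightarrow> face H A"
  unfolding face_def by blast

lemma face_tuples_iff: "t \<in> face_tuples H n \<longleftrightarrow> (\<exists>x. (x, t) \<in> K_pre H n)"
  by (auto simp: face_tuples_def face_def K_pre_def PiE_iff image_subset_iff)

lemma K_class_eq_tuple_cell:
  assumes "(x, t) \<in> K_pre H n"
  shows "K_class H n x t = tuple_cell H n t"
  using assms by (auto simp: K_class_def K_rel_iff tuple_cell_def)

lemma cells_K: "cells (K H) n = tuple_cell H n ` face_tuples H n"
proof -
  have "cells (K H) n = (\<lambda>(x, t). K_class H n x t) ` K_pre H n"
    by (auto simp: K_def quotient_def K_class_def)
  also have "\<dots> = (\<lambda>(x, t). tuple_cell H n t) ` K_pre H n"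
    by (intro image_cong refl) (auto simp: K_class_eq_tuple_cell)
  also have "\<dots> = tuple_cell H n ` face_tuples H n"
    by (force simp: face_tuples_iff)
  finally show ?thesis .
qed

lemma tuple_cell_inj:
  assumes "tuple_cell H n t = tuple_cell H n s" and "t \<in> face_tuples H n"
  shows "t = s"
  using assms by (auto simp: tuple_cell_def face_tuples_iff)

lemma compose_face_tuples:
  assumes "\<mu> \<in> sDelta_hom m n" and "t \<in> face_tuples H n"
  shows "compose {..m} t \<mu> \<in> face_tuples H m"
  using assms image_compose_subset[OF assms(1), of t] face_subset
  by (auto simp: face_tuples_def compose_extensional)

lemma act_tuple_cell:
  assumes "\<mu> \<in> sDelta_hom m n" and "t \<in> face_tuples H n"
  shows "act (K H) m n \<mu> (tuple_cell H n t) = tuple_cell H m (compose {..m} t \<mu>)"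
proof -
  obtain x where x: "(x, t) \<in> K_pre H n"
    using assms(2) face_tuples_iff by blast
  then have "(x, compose {..m} t \<mu>) \<in> K_pre H m"
    using assms(1) by (auto simp: K_pre_def compose_def PiE_iff)
  then show ?thesis
    using act_K_class[OF assms(1) x] x by (simp add: K_class_eq_tuple_cell)
qed

lemma sym_sset_K: "sym_sset (K H)"
proof
  fix \<mu> m n x
  assume "\<mu> \<in> sDelta_hom m n" "x \<in> cells (K H) n"
  then show "act (K H) m n \<mu> x \<in> cells (K H) m"
    by (auto simp: cells_K act_tuple_cell compose_face_tuples)
next
  fix x n
  assume "x \<in> cells (K H) n"
  then obtain t where t: "t \<in> face_tuples H n" "x = tuple_cell H n t"
    by (auto simp: cells_K)
  moreover have "compose {..n} t (restrict id {..n}) = t"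
    using t compose_Id[of t "{..n}" UNIV] by (simp add: face_tuples_def id_def)
  moreover have "restrict id {..n} \<in> sDelta_hom n n"
    by (intro restrict_PiE_iff[THEN iffD2]) simp
  ultimately show "act (K H) n n (restrict id {..n}) x = x"
    by (simp add: act_tuple_cell)
next
  fix \<mu> \<nu> x l m n
  assume \<mu>: "\<mu> \<in> sDelta_hom l m" and \<nu>: "\<nu> \<in> sDelta_hom m n" and "x \<in> cells (K H) n"
  then obtain t where t: "t \<in> face_tuples H n" "x = tuple_cell H n t"
    by (auto simp: cells_K)
  have "compose {..l} \<nu> \<mu> \<in> sDelta_hom l n"
    using \<mu> \<nu> by (simp add: compose_def PiE_iff)
  moreover have "compose {..l} t (compose {..l} \<nu> \<mu>) = compose {..l} (compose {..m} t \<nu>) \<mu>"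
    using \<mu> compose_assoc[of \<mu> "{..l}" "{..m}" t \<nu>] by (simp add: PiE_def)
  ultimately show "act (K H) l n (compose {..l} \<nu> \<mu>) x = act (K H) l m \<mu> (act (K H) m n \<nu> x)"
    using \<mu> \<nu> t by (simp add: act_tuple_cell compose_face_tuples)
qed

lemma finite_sym_sset_K:
  assumes "hypergraph H"
  shows "finite_sym_sset (K H)"
proof -
  interpret hypergraph H by fact
  have "finite (ext_ends H x)" if "x \<in> edges H <+> verts H" for x
    using that finite_subset[OF ends_subset finite_verts] by (auto simp: ext_ends_def)
  then have fin: "finite (K_pre H n)" for n
    using finite_edges finite_verts
    unfolding K_pre_def by (intro finite_SigmaI finite_PiE finite_Plus) auto
  have "finite (cells (K H) n)" for n
    using finite_quotient[OF fin equiv_type[OF equiv_K_rel]] by (simp add: K_def)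
  then show ?thesis
    by (intro finite_sym_sset.intro sym_sset_K finite_sym_sset_axioms.intro)
qed


section \<open>Closedness\<close>

definition cells_over :: "('e, 'v) hypergraph \<Rightarrow> 'v set
    \<Rightarrow> (nat \<times> (('e + 'v) \<times> (nat \<Rightarrow> 'v)) set) set" where
  "cells_over H A = {(n, tuple_cell H n s) | n s. s \<in> face_tuples H n \<and> A \<subseteq> s ` {..n}}"

lemma tuple_cell_in_cells_over_iff:
  assumes "s \<in> face_tuples H n"
  shows "(n, tuple_cell H n s) \<in> cells_over H A \<longleftrightarrow> A \<subseteq> s ` {..n}"
  using assms tuple_cell_inj[of H n s] by (auto simp: cells_over_def)

lemma cell_le_tuple_cell_iff:
  assumes t: "t \<in> face_tuples H m" and s: "s \<in> face_tuples H n"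
  shows "cell_le (K H) (m, tuple_cell H m t) (n, tuple_cell H n s) \<longleftrightarrow> t ` {..m} \<subseteq> s ` {..n}"
proof -
  have "act (K H) m n \<mu> (tuple_cell H n s) = tuple_cell H m t \<longleftrightarrow> compose {..m} s \<mu> = t"
    if "\<mu> \<in> sDelta_hom m n" for \<mu>
    using that s t tuple_cell_inj[of H m t] by (auto simp: act_tuple_cell)
  then have "cell_le (K H) (m, tuple_cell H m t) (n, tuple_cell H n s)
      \<longleftrightarrow> (\<exists>\<mu> \<in> sDelta_hom m n. compose {..m} s \<mu> = t)"
    by (simp add: cell_le_def)
  also have "\<dots> \<longleftrightarrow> t ` {..m} \<subseteq> s ` {..n}"
    using t by (intro reindexing_exists_iff) (simp add: face_tuples_def)
  finally show ?thesis .
qed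

lemma up_set_tuple_cell:
  assumes "t \<in> face_tuples H m"
  shows "up_set (K H) (m, tuple_cell H m t) = cells_over H (t ` {..m})"
  using assms
  by (auto simp: up_set_def total_cells_def cells_K cells_over_def cell_le_tuple_cell_iff)

lemma cells_over_Int: "cells_over H A \<inter> cells_over H B = cells_over H (A \<union> B)"
proof -
  have "z \<in> cells_over H A \<inter> cells_over H B \<longleftrightarrow> z \<in> cells_over H (A \<union> B)" for z
  proof (cases "\<exists>n s. s \<in> face_tuples H n \<and> z = (n, tuple_cell H n s)")
    case True
    then show ?thesis
      by (auto simp: tuple_cell_in_cells_over_iff)
  qed (auto simp: cells_over_def)
  then show ?thesis
    by blast
qed

text \<open>
  If some cell lies over \<open>A\<close>, then \<open>A\<close> is a finite face, and enumerating it gives the least such cell.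
\<close>

lemma cells_over_empty_or_up_set:
  fixes H :: "('e, 'v) hypergraph"
  assumes "A \<noteq> {}"
  shows "cells_over H A \<in> {{}} \<union> up_set (K H) ` total_cells (K H)"
proof (cases "cells_over H A = {}")
  case False
  then obtain n s where s: "s \<in> face_tuples H n" and sub: "A \<subseteq> s ` {..n}"
    by (auto simp: cells_over_def)
  have "face H A"
    using s sub face_subset[of H "s ` {..n}" A] by (simp add: face_tuples_def)
  have "finite A"
    by (rule finite_subset[OF sub]) simp
  obtain m and t :: "nat \<Rightarrow> 'v" where t: "t \<in> extensional {..m}" "t ` {..m} = A"
    by (rule exists_tuple_with_entries[OF \<open>finite A\<close> assms])
  then have "t \<in> face_tuples H m"
    using \<open>face H A\<close> by (simp add: face_tuples_def)
  then have "cells_over H A = up_set (K H) (m, tuple_cell H m t)"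
    and "(m, tuple_cell H m t) \<in> total_cells (K H)"
    using t by (simp_all add: up_set_tuple_cell total_cells_def cells_K)
  then show ?thesis
    by blast
qed simp

text \<open>
  The set \<open>A\<close> is required to be nonempty because \<open>cells_over H {}\<close> contains every cell, which in
  general is not an up-set of a single cell.
\<close>

lemma up_sets_as_cells_over:
  assumes "F \<in> {{}} \<union> up_set (K H) ` total_cells (K H)"
  shows "F = {} \<or> (\<exists>A. A \<noteq> {} \<and> F = cells_over H A)"
proof (cases "F = {}")
  case False
  then have "F \<in> up_set (K H) ` total_cells (K H)"
    using assms by simp
  then obtain z where z: "z \<in> total_cells (K H)" and F: "F = up_set (K H) z"
    by (rule imageE)
  obtain m t where "t \<in> face_tuples H m" and "z = (m, tuple_cell H m t)"
    using z by (auto simp: total_cells_def cells_K)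
  then have "F = cells_over H (t ` {..m})"
    by (simp add: F up_set_tuple_cell)
  moreover have "t ` {..m} \<noteq> {}"
    by simp
  ultimately show ?thesis
    by metis
qed simp

lemma closed_sset_K: "closed_sset (K H)"
  unfolding closed_sset_def
proof (intro allI impI; elim conjE)
  let ?U = "{{}} \<union> up_set (K H) ` total_cells (K H)"
  fix \<F>
  assume "finite \<F>" "\<F> \<noteq> {}" "\<F> \<subseteq> ?U"
  then show "\<Inter>\<F> \<in> ?U"
  proof (induction rule: finite_ne_induct)
    case (insert F \<F>)
    have sub: "F \<in> ?U \<and> \<F> \<subseteq> ?U"
      using insert.prems by (simp only: insert_subset)
    then have F: "F \<in> ?U"
      by (rule conjunct1)
    have \<F>: "\<Inter>\<F> \<in> ?U"
      using sub by (intro insert.IH) (rule conjunct2)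
    show ?case
    proof (cases "F = {} \<or> \<Inter>\<F> = {}")
      case False
      then obtain A B where "A \<noteq> {}" and "F = cells_over H A" and "\<Inter>\<F> = cells_over H B"
        using up_sets_as_cells_over[OF F] up_sets_as_cells_over[OF \<F>] by blast
      then have "\<Inter>(insert F \<F>) = cells_over H (A \<union> B)" and "A \<union> B \<noteq> {}"
        by (simp_all add: cells_over_Int)
      then show ?thesis
        using cells_over_empty_or_up_set by metis
    qed auto
  qed simp
qed


section \<open>The Cech property\<close>

lemma vertex_map_tuple_cell:
  assumes "t \<in> face_tuples H n"
  shows "vertex_map (K H) n (tuple_cell H n t)
    = (\<lambda>k\<in>{..n}. tuple_cell H 0 (\<lambda>_\<in>{..0}. t k))"
proof -
  have "act (K H) 0 n (\<lambda>_\<in>{..0}. k) (tuple_cell H n t) = tuple_cell H 0 (\<lambda>_\<in>{..0}. t k)"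
    if "k \<in> {..n}" for k
  proof -
    have "(\<lambda>_\<in>{..0}. k) \<in> sDelta_hom 0 n"
      using that by (intro restrict_PiE_iff[THEN iffD2]) simp
    moreover have "compose {..0::nat} t (\<lambda>_\<in>{..0}. k) = (\<lambda>_\<in>{..0}. t k)"
      unfolding compose_def by (rule restrict_ext) simp
    ultimately show ?thesis
      using assms by (simp only: act_tuple_cell)
  qed
  then show ?thesis
    unfolding vertex_map_def by (intro restrict_ext) simp
qed

lemma vertex_in_face_tuples:
  assumes "t \<in> face_tuples H n" and "k \<in> {..n}"
  shows "(\<lambda>_\<in>{..0}. t k) \<in> face_tuples H 0"
  using assms face_subset[of H "t ` {..n}" "{t k}"] by (auto simp: face_tuples_def)

lemma inj_on_vertex_map_K: "inj_on (vertex_map (K H) n) (cells (K H) n)"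
proof (rule inj_onI)
  fix x y
  assume "x \<in> cells (K H) n" "y \<in> cells (K H) n"
    and eq: "vertex_map (K H) n x = vertex_map (K H) n y"
  then obtain t s where t: "t \<in> face_tuples H n" "x = tuple_cell H n t"
    and s: "s \<in> face_tuples H n" "y = tuple_cell H n s"
    by (auto simp: cells_K)
  have "t k = s k" if k: "k \<in> {..n}" for k
  proof -
    have "tuple_cell H 0 (\<lambda>_\<in>{..0}. t k) = tuple_cell H 0 (\<lambda>_\<in>{..0}. s k)"
      using fun_cong[OF eq, of k] k t s by (simp add: vertex_map_tuple_cell)
    then have "(\<lambda>_\<in>{..0::nat}. t k) = (\<lambda>_\<in>{..0}. s k)"
      using tuple_cell_inj vertex_in_face_tuples[OF t(1) k] by blast
    then show ?thesis
      by (metis atMost_iff le0 restrict_apply')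
  qed
  then have "t = s"
    using t s by (intro extensionalityI[of t "{..n}" s]) (auto simp: face_tuples_def)
  then show "x = y"
    using t s by simp
qed

text \<open>
  A common element of the up-sets of finitely many vertices is a cell whose entries contain all of
  them; so these vertices span a face and, taken in the given order, form a cell.
\<close>

lemma cells_cech_K_subset: "cells (cech (K H)) n \<subseteq> vertex_map (K H) n ` cells (K H) n"
proof
  fix y
  assume "y \<in> cells (cech (K H)) n"
  then have y: "y \<in> {..n} \<rightarrow>\<^sub>E cells (K H) 0"
    and "(\<Inter>i\<in>{..n}. up_set (K H) (0, y i)) \<noteq> {}"
    unfolding cells_cech_iff by simp_all
  then obtain z where z: "\<And>i. i \<in> {..n} \<Longrightarrow> z \<in> up_set (K H) (0, y i)"
    by blast
  have "\<forall>i\<in>{..n}. \<exists>r\<in>face_tuples H 0. y i = tuple_cell H 0 r"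
    using y by (auto simp: cells_K)
  then obtain r where r: "\<And>i. i \<in> {..n} \<Longrightarrow> r i \<in> face_tuples H 0"
    and y_eq: "\<And>i. i \<in> {..n} \<Longrightarrow> y i = tuple_cell H 0 (r i)"
    by metis
  define t where "t = (\<lambda>i\<in>{..n}. r i 0)"
  from z[of 0] obtain m s where s: "s \<in> face_tuples H m" and z_eq: "z = (m, tuple_cell H m s)"
    by (auto simp: up_set_def total_cells_def cells_K)
  have "t i \<in> s ` {..m}" if i: "i \<in> {..n}" for i
  proof -
    have "(m, tuple_cell H m s) \<in> cells_over H (r i ` {..0})"
      using z[OF i] r[OF i] by (simp add: z_eq y_eq[OF i] up_set_tuple_cell)
    then show ?thesis
      using s i by (simp add: tuple_cell_in_cells_over_iff t_def)
  qed
  then have "t ` {..n} \<subseteq> s ` {..m}"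
    by (rule image_subsetI)
  then have "face H (t ` {..n})"
    using s face_subset[of H "s ` {..m}"] by (simp add: face_tuples_def)
  then have t: "t \<in> face_tuples H n"
    by (simp add: face_tuples_def t_def)
  have "tuple_cell H 0 (\<lambda>_\<in>{..0}. t i) = y i" if i: "i \<in> {..n}" for i
  proof -
    have "(\<lambda>_\<in>{..0}. t i) = r i"
      using r[OF i] i by (auto simp: face_tuples_def t_def extensional_def fun_eq_iff)
    then show ?thesis
      by (simp only: y_eq[OF i])
  qed
  then have "vertex_map (K H) n (tuple_cell H n t) = restrict y {..n}"
    unfolding vertex_map_tuple_cell[OF t] by (rule restrict_ext)
  also have "\<dots> = y"
    using y by (rule PiE_restrict)
  finally have "vertex_map (K H) n (tuple_cell H n t) = y" .
  then show "y \<in> vertex_map (K H) n ` cells (K H) n"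
    using t by (auto simp: cells_K)
qed

lemma cech_sset_K: "cech_sset (K H)"
  using sym_sset_K inj_on_vertex_map_K cells_cech_K_subset by (rule cech_ssetI)

theorem theorem4p8:
  fixes H :: "('e, 'v) hypergraph"
  assumes "hypergraph H"
  shows "finite_sym_sset (K H) \<and> closed_sset (K H) \<and> cech_sset (K H)"
  using finite_sym_sset_K[OF assms] closed_sset_K cech_sset_K by blast

end
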